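(* Let $J$ be an ideal on $\omega$. The following are equivalent: (i) $\mathcal{N}_J\subsetneq\mathcal{N}$; (ii) $\mathcal{M}\cap\mathcal{N}\not\subseteq\mathcal{N}_J$; (iii) $J$ is not meager.
   Context: An ideal on $\omega$ is a family $J\subseteq\mathcal{P}(\omega)$ closed under subsets and finite unions, containing all finite sets, with $\omega\notin J$; it is viewed as a subset of $\mathcal{P}(\omega)\cong{}^\omega2$ for "meager". $J^+=\mathcal{P}(\omega)\setminus J$. ${}^\omega2$ has Lebesgue measure $\mu$; $\Omega$ is the set of clopen subsets. For $\bar c\in{}^\omega\Omega$, $N(\bar c)=\{x:x\in c_n\text{ for infinitely many }n\}$, $\overline{\Omega}=\{\bar c\in{}^\omega\Omega:\mu(N(\bar c))=0\}$, $N_J(\bar c)=\{x:\{n:x\in c_n\}\in J^+\}$, $\mathcal{N}_J=\{X\subseteq{}^\omega2:\exists\bar c\in\overline{\Omega}\ X\subseteq N_J(\bar c)\}$. $\mathcal{N}$ and $\mathcal{M}$ are the ideals of Lebesgue null and of meager subsets of ${}^\omega2$. *)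

theory Defs
  imports "HOL-Probability.Probability"
begin

type_synonym cantor = "nat \<Rightarrow> bool"

definition ideal_on_omega :: "nat set set \<Rightarrow> bool" where
  "ideal_on_omega J \<longleftrightarrow>
     (\<forall>A\<in>J. \<forall>B. B \<subseteq> A \<longrightarrow> B \<in> J) \<and>
     (\<forall>A\<in>J. \<forall>B\<in>J. A \<union> B \<in> J) \<and>
     (\<forall>A. finite A \<longrightarrow> A \<in> J) \<and>
     UNIV \<notin> J"

definition positive_sets :: "nat set set \<Rightarrow> nat set set" where
  "positive_sets J = UNIV - J"

definition nowhere_dense :: "'a::topological_space set \<Rightarrow> bool" where
  "nowhere_dense A \<longleftrightarrow> interior (closure A) = {}"

definition meager :: "'a::topological_space set \<Rightarrow> bool" where
  "meager A \<longleftrightarrow> (\<exists>F :: nat \<Rightarrow> 'a set. (\<forall>n. nowhere_dense (F n)) \<and> A = (\<Union>n. F n))"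

text \<open>A family of subsets of \<open>\<omega>\<close> viewed as a subset of the Cantor space, via
  characteristic functions.\<close>

definition cantor_of :: "nat set set \<Rightarrow> cantor set" where
  "cantor_of J = (\<lambda>A n. n \<in> A) ` J"

text \<open>Lebesgue measure on the Cantor space is the completed product of the fair-coin measures.
  Nullness is always expressed by \<^const>\<open>null_sets\<close>, because \<^const>\<open>emeasure\<close> takes the
  value 0 on non-measurable sets.\<close>

definition cantor_measure :: "cantor measure" where
  "cantor_measure = completion (Pi\<^sub>M UNIV (\<lambda>_. measure_pmf (bernoulli_pmf (1/2))))"

definition null_ideal :: "cantor set set" where
  "null_ideal = null_sets cantor_measure"

definition meager_ideal :: "cantor set set" where
  "meager_ideal = {X. meager X}"

definition clopen_sets :: "cantor set set" where
  "clopen_sets = {c. open c \<and> closed c}"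

definition N_limsup :: "(nat \<Rightarrow> cantor set) \<Rightarrow> cantor set" where
  "N_limsup c = {x. infinite {n. x \<in> c n}}"

definition Omega_bar :: "(nat \<Rightarrow> cantor set) set" where
  "Omega_bar = {c. (\<forall>n. c n \<in> clopen_sets) \<and> N_limsup c \<in> null_sets cantor_measure}"

definition N_J_set :: "nat set set \<Rightarrow> (nat \<Rightarrow> cantor set) \<Rightarrow> cantor set" where
  "N_J_set J c = {x. {n. x \<in> c n} \<in> positive_sets J}"

definition N_J_family :: "nat set set \<Rightarrow> cantor set set" where
  "N_J_family J = {X. \<exists>c\<in>Omega_bar. X \<subseteq> N_J_set J c}"

end

theory Submission
  imports Defs
begin

text \<open>If \<open>J\<close> is meager, there is an interval partition such that no set in \<open>J\<close> contains infinitely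
  many of the intervals; repeating \<open>c k\<close> along the \<open>k\<close>-th interval gives \<open>N(c) \<subseteq> N\<^sub>J(c')\<close>, and every
  null set lies in some \<open>N(c)\<close>.

  If \<open>J\<close> is not meager, every interval partition has infinitely many intervals inside one set of \<open>J\<close>.
  The null meager set that escapes \<open>N\<^sub>J\<close> consists of the points that vanish on infinitely many dyadic
  blocks but equal 1 throughout only finitely many. Given \<open>c\<close>, interleave a partition of the indices
  of \<open>c\<close> with dyadic blocks so that earlier \<open>c n\<close> do not depend on a block, while later ones are tiny
  compared with the measure of the points vanishing on it. A random point made to vanish on
  the blocks with index in an infinite set \<open>K\<close> then avoids, with positive probability, all \<open>c n\<close>
  outside the intervals with index in \<open>K\<close>.\<close>

section \<open>Cylinders\<close>

definition cylinder :: "cantor \<Rightarrow> nat \<Rightarrow> cantor set" where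
  "cylinder x n = {y. \<forall>i<n. y i = x i}"

definition determined_below :: "nat \<Rightarrow> cantor set \<Rightarrow> bool" where
  "determined_below n c \<longleftrightarrow> (\<forall>x\<in>c. cylinder x n \<subseteq> c)"

lemma self_in_cylinder [simp]: "x \<in> cylinder x n"
  by (simp add: cylinder_def)

lemma cylinder_antimono: "m \<le> n \<Longrightarrow> cylinder x n \<subseteq> cylinder x m"
  by (auto simp: cylinder_def)

lemma cylinder_eq: "y \<in> cylinder x n \<Longrightarrow> cylinder y n = cylinder x n"
  by (auto simp: cylinder_def)

lemma determined_below_mono: "determined_below m c \<Longrightarrow> m \<le> n \<Longrightarrow> determined_below n c"
  unfolding determined_below_def using cylinder_antimono by blast

lemma determined_below_cong:
  assumes "determined_below n c" "\<And>i. i < n \<Longrightarrow> x i = y i"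
  shows "x \<in> c \<longleftrightarrow> y \<in> c"
proof -
  have "x \<in> cylinder y n" "y \<in> cylinder x n"
    using assms(2) by (simp_all add: cylinder_def)
  then show ?thesis using assms(1) by (auto simp: determined_below_def)
qed

lemma determined_below_Compl:
  assumes "determined_below n c"
  shows "determined_below n (- c)"
  unfolding determined_below_def
proof (intro ballI subsetI)
  fix x y assume "x \<in> - c" "y \<in> cylinder x n"
  then show "y \<in> - c"
    using determined_below_cong[OF assms, of x y] by (simp add: cylinder_def)
qed

lemma determined_below_Un:
  "determined_below n c \<Longrightarrow> determined_below n d \<Longrightarrow> determined_below n (c \<union> d)"
  unfolding determined_below_def by blast

lemma determined_below_UN:
  "(\<And>i. i \<in> I \<Longrightarrow> determined_below n (c i)) \<Longrightarrow> determined_below n (\<Union>i\<in>I. c i)"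
  unfolding determined_below_def by blast

lemma determined_below_Diff:
  "determined_below n c \<Longrightarrow> determined_below n d \<Longrightarrow> determined_below n (c - d)"
  using determined_below_Compl[OF determined_below_Un[OF determined_below_Compl]]
  by (simp add: Diff_eq)

section \<open>Open and clopen subsets of the Cantor space\<close>

lemma open_singleton_bool: "open {b :: bool}"
proof (cases b)
  case True
  then have "{b} = {False<..}" by auto
  then show ?thesis by (metis open_greaterThan)
next
  case False
  then have "{b} = {..<True}" by auto
  then show ?thesis by (metis open_lessThan)
qed

lemma open_cylinder: "open (cylinder x n)"
proof -
  have "open {f :: cantor. \<forall>i\<in>{..<n}. f (id i) \<in> {x i}}"
    by (rule product_topology_basis') (auto simp: open_singleton_bool)
  moreover have "{f :: cantor. \<forall>i\<in>{..<n}. f (id i) \<in> {x i}} = cylinder x n"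
    by (auto simp: cylinder_def)
  ultimately show ?thesis by simp
qed

lemma open_contains_cylinder:
  assumes "open U" "x \<in> U"
  obtains n where "cylinder x n \<subseteq> U"
proof -
  obtain X where X: "x \<in> Pi\<^sub>E UNIV X" "finite {i. X i \<noteq> UNIV}" "Pi\<^sub>E UNIV X \<subseteq> U"
    using product_topology_open_contains_basis[of "\<lambda>_. euclidean :: bool topology" UNIV U x] assms
    by (auto simp: open_fun_def)
  obtain n where n: "\<And>i. i \<in> {i. X i \<noteq> UNIV} \<Longrightarrow> i < n"
    using X(2) finite_nat_set_iff_bounded by auto
  have "cylinder x n \<subseteq> Pi\<^sub>E UNIV X"
  proof
    fix y assume y: "y \<in> cylinder x n"
    have "y i \<in> X i" for i
    proof (cases "X i = UNIV")
      case False
      then show ?thesis using n[of i] y X(1) by (auto simp: cylinder_def PiE_iff)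
    qed simp
    then show "y \<in> Pi\<^sub>E UNIV X" by auto
  qed
  then show ?thesis using X(3) by (intro that[of n]) (rule subset_trans)
qed

lemma open_cantor_iff: "open U \<longleftrightarrow> (\<forall>x\<in>U. \<exists>n. cylinder x n \<subseteq> U)" for U :: "cantor set"
proof
  assume *: "\<forall>x\<in>U. \<exists>n. cylinder x n \<subseteq> U"
  show "open U"
  proof (rule topological_space_class.openI)
    fix x assume "x \<in> U"
    with * obtain n where "cylinder x n \<subseteq> U" by blast
    then show "\<exists>T. open T \<and> x \<in> T \<and> T \<subseteq> U"
      by (intro exI[of _ "cylinder x n"]) (simp add: open_cylinder)
  qed
next
  assume "open U"
  then show "\<forall>x\<in>U. \<exists>n. cylinder x n \<subseteq> U"
    by (meson open_contains_cylinder)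
qed

lemma clopen_if_determined_below:
  assumes "determined_below n c"
  shows "c \<in> clopen_sets"
proof -
  have "open d" if "determined_below n d" for d
    unfolding open_cantor_iff
    by (intro ballI exI[of _ n]) (use that in \<open>simp add: determined_below_def\<close>)
  from this[OF assms] this[OF determined_below_Compl[OF assms]] show ?thesis
    unfolding clopen_sets_def closed_def mem_Collect_eq by (rule conjI)
qed

lemma compact_cantor: "compact (UNIV :: cantor set)"
proof -
  have "compact_space (product_topology (\<lambda>_. euclidean :: bool topology) (UNIV :: nat set))"
    unfolding compact_space_product_topology
    by (simp add: compact_space_def finite_imp_compact)
  then show ?thesis
    by (simp add: euclidean_product_topology compact_space_def)
qed

text \<open>By compactness, finitely many cylinders, each inside \<open>c\<close> or inside its
  complement, cover the space; beyond the greatest of their lengths no coordinate can affect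
  membership in \<open>c\<close>.\<close>

lemma clopen_determined_below:
  assumes "c \<in> clopen_sets"
  obtains n where "determined_below n c"
proof -
  have "\<exists>n. cylinder x n \<subseteq> c \<or> cylinder x n \<subseteq> - c" for x
  proof (cases "x \<in> c")
    case True
    moreover have "open c" using assms by (simp add: clopen_sets_def)
    ultimately show ?thesis by (meson open_contains_cylinder)
  next
    case False
    moreover have "open (- c)" using assms by (simp add: clopen_sets_def open_Compl)
    ultimately show ?thesis by (meson ComplI open_contains_cylinder)
  qed
  then obtain f where f: "\<And>x. cylinder x (f x) \<subseteq> c \<or> cylinder x (f x) \<subseteq> - c"
    by metis
  obtain T where T: "finite T" "UNIV \<subseteq> (\<Union>x\<in>T. cylinder x (f x))"
    by (rule compactE_image[OF compact_cantor, of UNIV "\<lambda>x. cylinder x (f x)"])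
       (use self_in_cylinder in \<open>auto simp: open_cylinder\<close>)
  obtain n where n: "\<And>x. x \<in> T \<Longrightarrow> f x \<le> n"
    using T(1) by (metis Max_ge finite_imageI imageI)
  have "determined_below n c"
    unfolding determined_below_def
  proof
    fix y assume y: "y \<in> c"
    obtain x where x: "x \<in> T" "y \<in> cylinder x (f x)" using T(2) by blast
    have "cylinder y n \<subseteq> cylinder x (f x)"
      using cylinder_antimono[OF n[OF x(1)], of y] cylinder_eq[OF x(2)] by simp
    with f[of x] x(2) y show "cylinder y n \<subseteq> c" by auto
  qed
  then show ?thesis by (rule that)
qed

section \<open>Meager ideals and interval partitions\<close>

lemma nowhere_dense_subset:
  assumes "nowhere_dense B" "A \<subseteq> B"
  shows "nowhere_dense A"
  using assms interior_mono[OF closure_mono[OF assms(2)]] by (auto simp: nowhere_dense_def)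

lemma nowhere_dense_Un: "nowhere_dense A \<Longrightarrow> nowhere_dense B \<Longrightarrow> nowhere_dense (A \<union> B)"
  by (simp add: nowhere_dense_def interior_closed_Un_empty_interior)

lemma nowhere_dense_UN_atMost:
  fixes F :: "nat \<Rightarrow> 'a::topological_space set"
  assumes "\<And>i. nowhere_dense (F i)"
  shows "nowhere_dense (\<Union>i\<le>k. F i)"
  by (induction k) (simp_all add: assms nowhere_dense_Un atMost_Suc)

lemma meager_subset:
  assumes "meager B" "A \<subseteq> B"
  shows "meager A"
proof -
  obtain F where F: "\<And>n::nat. nowhere_dense (F n)" "B = (\<Union>n. F n)"
    using assms(1) by (auto simp: meager_def)
  have "A = (\<Union>n. F n \<inter> A)" using F(2) assms(2) by auto
  moreover have "nowhere_dense (F n \<inter> A)" for n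
    using nowhere_dense_subset[OF F(1)] by blast
  ultimately show ?thesis unfolding meager_def by metis
qed

lemma nowhere_dense_avoiding_cylinder:
  assumes "nowhere_dense F"
  obtains y m where "n \<le> m" "y \<in> cylinder x n" "cylinder y m \<inter> F = {}"
proof -
  have "\<not> cylinder x n \<subseteq> closure F"
    using assms interior_maximal[OF _ open_cylinder, of x n "closure F"] self_in_cylinder[of x n]
    unfolding nowhere_dense_def by blast
  then obtain y where y: "y \<in> cylinder x n" "y \<in> - closure F" by blast
  obtain m where "cylinder y m \<subseteq> - closure F"
    using open_contains_cylinder[of "- closure F" y] y(2) by (meson closed_closure open_Compl)
  then have "cylinder y (max n m) \<inter> F = {}"
    using cylinder_antimono[of m "max n m" y] closure_subset[of F] by auto
  then show ?thesis using that[of "max n m" y] y(1) by auto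
qed

lemma finite_support_below: "finite {t :: cantor. \<forall>i\<ge>n. \<not> t i}"
proof (rule finite_subset)
  show "{t :: cantor. \<forall>i\<ge>n. \<not> t i} \<subseteq> (\<lambda>A i. i \<in> A) ` Pow {..<n}"
  proof
    fix t :: cantor assume "t \<in> {t. \<forall>i\<ge>n. \<not> t i}"
    then show "t \<in> (\<lambda>A i. i \<in> A) ` Pow {..<n}"
      by (intro image_eqI[of _ _ "{i. t i}"]) (auto simp: not_le[symmetric])
  qed
qed simp

text \<open>Running through the finitely many patterns below \<open>n\<close>, one extends a single block so that it
  leaves \<open>F\<close> no matter what precedes it.\<close>
lemma nowhere_dense_avoiding_block:
  fixes F :: "cantor set"
  assumes F: "nowhere_dense F"
  shows "\<exists>m>n. \<exists>s. \<forall>x. (\<forall>i\<in>{n..<m}. x i = s i) \<longrightarrow> x \<notin> F"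
proof -
  have "\<exists>m>n. \<exists>s. \<forall>t\<in>T. \<forall>x. (\<forall>i<n. x i = t i) \<and> (\<forall>i\<in>{n..<m}. x i = s i) \<longrightarrow> x \<notin> F"
    if "finite T" for T :: "cantor set"
    using that
  proof (induction T)
    case empty
    then show ?case by auto
  next
    case (insert t T)
    then obtain m s where m: "m > n"
      and s: "\<forall>u\<in>T. \<forall>x. (\<forall>i<n. x i = u i) \<and> (\<forall>i\<in>{n..<m}. x i = s i) \<longrightarrow> x \<notin> F"
      by (elim exE conjE)
    \<comment> \<open>\<open>z\<close> prolongs the new pattern \<open>t\<close> by the block
      \<open>s\<close> built so far. Searching inside \<open>cylinder z m\<close> keeps
      \<open>s\<close> on \<open>{n..<m}\<close>, so the patterns treated earlier stay
      excluded.\<close>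
    define z where "z = (\<lambda>i. if i < n then t i else s i)"
    obtain y m' where y: "m \<le> m'" "y \<in> cylinder z m" "cylinder y m' \<inter> F = {}"
      using nowhere_dense_avoiding_cylinder[OF F] .
    have yt: "y i = t i" if "i < n" for i using y(2) that m by (auto simp: cylinder_def z_def)
    have ys: "y i = s i" if "i \<in> {n..<m}" for i using y(2) that by (auto simp: cylinder_def z_def)
    have "x \<notin> F" if u: "u \<in> insert t T" "\<forall>i<n. x i = u i" "\<forall>i\<in>{n..<m'}. x i = y i" for u x
    proof (cases "u = t")
      case True
      then have "x \<in> cylinder y m'" using u yt unfolding cylinder_def by (auto simp: not_less)
      then show ?thesis using y(3) by blast
    next
      case False
      then have "u \<in> T" using u(1) by simp
      moreover have "\<forall>i\<in>{n..<m}. x i = s i" using u(3) ys y(1) by simp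
      ultimately show ?thesis using s u(2) by blast
    qed
    moreover have "n < m'" using m y(1) by simp
    ultimately show ?case by (intro exI[of _ m'] exI[of _ y] conjI ballI allI impI) auto
  qed
  from this[OF finite_support_below[of n]] obtain m s where m: "m > n"
    and s: "\<forall>t\<in>{t. \<forall>i\<ge>n. \<not> t i}. \<forall>x. (\<forall>i<n. x i = t i) \<and> (\<forall>i\<in>{n..<m}. x i = s i) \<longrightarrow> x \<notin> F"
    by (elim exE conjE)
  have "x \<notin> F" if "\<forall>i\<in>{n..<m}. x i = s i" for x
    using s[rule_format, of "\<lambda>i. i < n \<and> x i" x] that by simp
  with m show ?thesis by (intro exI[of _ m] exI[of _ s] conjI) simp_all
qed

lemma strict_mono_interval_exists:
  fixes m :: "nat \<Rightarrow> nat"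
  assumes "strict_mono m" "m 0 \<le> n"
  shows "\<exists>k. n \<in> {m k..<m (Suc k)}"
proof -
  define k where "k = (LEAST k. n < m (Suc k))"
  have "n < m (Suc n)"
    using strict_mono_imp_increasing[OF assms(1), of "Suc n"] by simp
  then have "n < m (Suc k)" unfolding k_def by (rule LeastI)
  moreover have "m k \<le> n"
  proof (cases k)
    case (Suc l)
    then show ?thesis using not_less_Least[of l "\<lambda>k. n < m (Suc k)"] by (simp add: k_def)
  qed (use assms(2) in simp)
  ultimately show ?thesis by auto
qed

lemma strict_mono_interval_unique:
  fixes m :: "nat \<Rightarrow> nat"
  assumes "strict_mono m" "i \<in> {m k..<m (Suc k)}" "i \<in> {m l..<m (Suc l)}"
  shows "k = l"
proof (rule ccontr)
  assume "k \<noteq> l"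
  then consider "Suc k \<le> l" | "Suc l \<le> k" by linarith
  then show False
    using assms strict_mono_less_eq[OF assms(1), of "Suc k" l] strict_mono_less_eq[OF assms(1), of "Suc l" k]
    by cases auto
qed

text \<open>One half of the Jalali-Naini--Talagrand characterisation of meager ideals.\<close>
lemma meager_ideal_partition:
  assumes J: "\<forall>A\<in>J. \<forall>B. B \<subseteq> A \<longrightarrow> B \<in> J" and "meager (cantor_of J)"
  obtains m :: "nat \<Rightarrow> nat" where "m 0 = 0" "strict_mono m"
    "\<forall>A\<in>J. finite {k. {m k..<m (Suc k)} \<subseteq> A}"
proof -
  obtain F where F: "\<And>n::nat. nowhere_dense (F n)" "cantor_of J = (\<Union>n. F n)"
    using assms(2) by (auto simp: meager_def)
  define G where "G k = (\<Union>i\<le>k. F i)" for k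
  have G: "nowhere_dense (G k)" for k
    unfolding G_def by (rule nowhere_dense_UN_atMost[OF F(1)])
  \<comment> \<open>The invariant \<open>k = 0 \<longrightarrow> a = 0\<close> in the choice below
    only fixes the start \<open>m 0 = 0\<close>, which makes the intervals cover all natural
    numbers.\<close>
  have "\<exists>m. m 0 = 0 \<and> (\<forall>k. m (Suc k) > m k \<and>
      (\<exists>s. \<forall>x. (\<forall>i\<in>{m k..<m (Suc k)}. x i = s i) \<longrightarrow> x \<notin> G k))"
    using dependent_nat_choice[of "\<lambda>k a. k = 0 \<longrightarrow> a = 0"
      "\<lambda>k a b. b > a \<and> (\<exists>s. \<forall>x. (\<forall>i\<in>{a..<b}. x i = s i) \<longrightarrow> x \<notin> G k)"]
      nowhere_dense_avoiding_block[OF G] by auto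
  then obtain m where m0: "m 0 = 0" and m_step: "\<forall>k. m (Suc k) > m k \<and>
      (\<exists>s. \<forall>x. (\<forall>i\<in>{m k..<m (Suc k)}. x i = s i) \<longrightarrow> x \<notin> G k)"
    by (elim exE conjE)
  then have m: "m (Suc k) > m k" for k by simp
  have ex: "\<forall>k. \<exists>s. \<forall>x. (\<forall>i\<in>{m k..<m (Suc k)}. x i = s i) \<longrightarrow> x \<notin> G k"
    using m_step by simp
  obtain s where s: "\<forall>k x. (\<forall>i\<in>{m k..<m (Suc k)}. x i = s k i) \<longrightarrow> x \<notin> G k"
    using choice[OF ex] by (elim exE)
  have sm: "strict_mono m" using m by (simp add: strict_mono_Suc_iff)
  have "finite {k. {m k..<m (Suc k)} \<subseteq> A}" if A: "A \<in> J" for A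
  proof (rule ccontr)
    assume inf: "infinite {k. {m k..<m (Suc k)} \<subseteq> A}"
    \<comment> \<open>\<open>B\<close> copies the block \<open>s k\<close> on each interval
      contained in \<open>A\<close> and is empty elsewhere. As a subset of \<open>A\<close> it is in
      \<open>J\<close>, yet it leaves \<open>G k\<close> for infinitely many
      \<open>k\<close>.\<close>
    define B where "B = {i. \<exists>k. {m k..<m (Suc k)} \<subseteq> A \<and> i \<in> {m k..<m (Suc k)} \<and> s k i}"
    have "B \<in> J" by (rule J[rule_format, OF A]) (auto simp: B_def)
    then obtain n where n: "(\<lambda>i. i \<in> B) \<in> F n"
      using F(2) unfolding cantor_of_def by blast
    obtain k where k: "k \<ge> n" "{m k..<m (Suc k)} \<subseteq> A"
      using inf unfolding infinite_nat_iff_unbounded_le by blast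
    have "(\<lambda>i. i \<in> B) \<notin> G k"
      by (rule s[rule_format]) (use k strict_mono_interval_unique[OF sm] in \<open>auto simp: B_def\<close>)
    with n k(1) show False by (auto simp: G_def)
  qed
  then have "\<forall>A\<in>J. finite {k. {m k..<m (Suc k)} \<subseteq> A}" by (rule ballI)
  with m0 sm show ?thesis by (rule that)
qed

text \<open>For fixed \<open>k\<close> the set is closed, and any initial segment can be continued
  with \<open>True\<close> throughout, which fills some later \<open>I j\<close> completely; so it
  is nowhere dense. The lower bound on \<open>I k\<close> places that \<open>I j\<close> beyond the
  initial segment.\<close>

lemma meager_eventually_omits:
  assumes fin: "\<And>k. finite (I k)" and unb: "\<And>k. I k \<subseteq> {k..}"
  shows "meager {x :: cantor. \<exists>k. \<forall>j\<ge>k. \<exists>n\<in>I j. \<not> x n}"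
proof -
  have "nowhere_dense {x :: cantor. \<forall>j\<ge>k. \<exists>n\<in>I j. \<not> x n}" (is "nowhere_dense ?F") for k
  proof -
    have "open (- ?F)"
      unfolding open_cantor_iff
    proof
      fix x assume "x \<in> - ?F"
      then obtain j where j: "j \<ge> k" "\<forall>n\<in>I j. x n" by auto
      obtain l where "\<And>i. i \<in> I j \<Longrightarrow> i < l"
        using fin[of j] finite_nat_set_iff_bounded by auto
      then have "cylinder x l \<subseteq> - ?F" using j by (auto simp: cylinder_def)
      then show "\<exists>l. cylinder x l \<subseteq> - ?F" by blast
    qed
    then have cl: "closure ?F = ?F" unfolding closure_eq closed_def .
    have "x \<notin> interior ?F" for x
    proof
      assume "x \<in> interior ?F"
      then obtain l where l: "cylinder x l \<subseteq> interior ?F"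
        by (meson open_contains_cylinder open_interior)
      define y where "y = (\<lambda>i. if i < l then x i else True)"
      have "y \<in> cylinder x l" by (simp add: y_def cylinder_def)
      moreover have "y n" if "n \<in> I (max k l)" for n
        using unb[of "max k l"] that by (auto simp: y_def)
      then have "y \<notin> ?F" by (auto intro!: exI[of _ "max k l"])
      ultimately show False using l interior_subset[of ?F] by blast
    qed
    then show ?thesis by (auto simp: nowhere_dense_def cl)
  qed
  moreover have "{x :: cantor. \<exists>k. \<forall>j\<ge>k. \<exists>n\<in>I j. \<not> x n} = (\<Union>k. {x. \<forall>j\<ge>k. \<exists>n\<in>I j. \<not> x n})"
    by auto
  ultimately show ?thesis
    unfolding meager_def by (intro exI[of _ "\<lambda>k. {x. \<forall>j\<ge>k. \<exists>n\<in>I j. \<not> x n}"] conjI allI)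
qed

text \<open>The other half of the Jalali-Naini--Talagrand characterisation, by contraposition: if
  every member of \<open>J\<close> contained only finitely many intervals, all characteristic
  functions would lie in the meager set of \<open>meager_eventually_omits\<close>.\<close>

lemma nonmeager_family_contains_intervals:
  assumes "\<not> meager (cantor_of J)" and m: "strict_mono (m :: nat \<Rightarrow> nat)"
  obtains A where "A \<in> J" "infinite {k. {m k..<m (Suc k)} \<subseteq> A}"
proof (rule ccontr)
  assume no: "\<not> thesis"
  have "cantor_of J \<subseteq> {x. \<exists>k. \<forall>j\<ge>k. \<exists>n\<in>{m j..<m (Suc j)}. \<not> x n}"
  proof
    fix x assume "x \<in> cantor_of J"
    then obtain A where A: "A \<in> J" "x = (\<lambda>n. n \<in> A)" by (auto simp: cantor_of_def)
    have "finite {k. {m k..<m (Suc k)} \<subseteq> A}" using no that A(1) by blast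
    then obtain k where "\<And>j. {m j..<m (Suc j)} \<subseteq> A \<Longrightarrow> j < k"
      unfolding finite_nat_set_iff_bounded by blast
    then have "\<forall>j\<ge>k. \<exists>n\<in>{m j..<m (Suc j)}. \<not> x n"
      using A(2) by (meson leD subsetI)
    then show "x \<in> {x. \<exists>k. \<forall>j\<ge>k. \<exists>n\<in>{m j..<m (Suc j)}. \<not> x n}" by blast
  qed
  moreover have "meager {x :: cantor. \<exists>k. \<forall>j\<ge>k. \<exists>n\<in>{m j..<m (Suc j)}. \<not> x n}"
    by (rule meager_eventually_omits)
       (auto intro: order_trans[OF strict_mono_imp_increasing[OF m]])
  ultimately show False using assms(1) meager_subset by blast
qed

section \<open>The coin-tossing measure\<close>

definition coin_measure :: "cantor measure" where
  "coin_measure = Pi\<^sub>M UNIV (\<lambda>_. measure_pmf (bernoulli_pmf (1/2)))"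

lemma cantor_measure_eq: "cantor_measure = completion coin_measure"
  by (simp add: cantor_measure_def coin_measure_def)

interpretation fair_coins: product_prob_space "\<lambda>_. measure_pmf (bernoulli_pmf (1/2))" "UNIV :: nat set"
  by unfold_locales

interpretation coin: prob_space coin_measure
  unfolding coin_measure_def by (rule fair_coins.P.prob_space_axioms)

lemma space_coin [simp]: "space coin_measure = UNIV"
  by (simp add: coin_measure_def space_PiM)

lemma pattern_eq_prod_emb:
  "{y. \<forall>i\<in>S. y i \<in> F i} =
    prod_emb UNIV (\<lambda>_. measure_pmf (bernoulli_pmf (1/2))) S (\<Pi>\<^sub>E i\<in>S. F i)"
  by (auto simp: prod_emb_def)

lemma pattern_in_sets: "finite S \<Longrightarrow> {y. \<forall>i\<in>S. y i = x i} \<in> sets coin_measure"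
  using pattern_eq_prod_emb[of S "\<lambda>i. {x i}"]
  by (simp add: coin_measure_def sets_PiM_I)

lemma measure_pattern:
  assumes "finite S"
  shows "measure coin_measure {y. \<forall>i\<in>S. y i = x i} = (1/2) ^ card S"
proof -
  have "pmf (bernoulli_pmf (1/2)) b = 1/2" for b by (cases b) auto
  then show ?thesis
    using pattern_eq_prod_emb[of S "\<lambda>i. {x i}"] assms
    by (simp add: coin_measure_def fair_coins.measure_PiM_emb measure_pmf_single)
qed

lemma determined_below_in_sets:
  assumes "determined_below n c"
  shows "c \<in> sets coin_measure"
proof -
  \<comment> \<open>\<open>T\<close> holds one point per cylinder of length \<open>n\<close> inside
    \<open>c\<close>, namely the one that is \<open>False\<close> from \<open>n\<close> on.\<close>
  define T where "T = {t. \<forall>i\<ge>n. \<not> t i} \<inter> c"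
  have "finite T" unfolding T_def using finite_support_below by simp
  moreover have "cylinder t n \<in> sets coin_measure" for t
    using pattern_in_sets[of "{..<n}" t] by (simp add: cylinder_def lessThan_def)
  moreover have "c = (\<Union>t\<in>T. cylinder t n)"
  proof
    show "c \<subseteq> (\<Union>t\<in>T. cylinder t n)"
    proof
      fix x assume x: "x \<in> c"
      define t where "t = (\<lambda>i. i < n \<and> x i)"
      have "t \<in> c" using determined_below_cong[OF assms, of t x] x by (simp add: t_def)
      then have "t \<in> T" by (auto simp: T_def t_def)
      moreover have "x \<in> cylinder t n" by (simp add: cylinder_def t_def)
      ultimately show "x \<in> (\<Union>t\<in>T. cylinder t n)" by blast
    qed
    show "(\<Union>t\<in>T. cylinder t n) \<subseteq> c"
      using assms by (auto simp: T_def determined_below_def)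
  qed
  ultimately show ?thesis by (metis (no_types, lifting) sets.finite_UN)
qed

lemma clopen_in_sets: "c \<in> clopen_sets \<Longrightarrow> c \<in> sets coin_measure"
  by (meson clopen_determined_below determined_below_in_sets)

section \<open>Clopen approximation, regularity and covers of null sets\<close>

definition cylinder_core :: "cantor set \<Rightarrow> nat \<Rightarrow> cantor set" where
  "cylinder_core U n = {x. cylinder x n \<subseteq> U}"

lemma determined_below_cylinder_core: "determined_below n (cylinder_core U n)"
  unfolding determined_below_def cylinder_core_def using cylinder_eq by blast

lemma UN_cylinder_core:
  assumes "open U"
  shows "(\<Union>n. cylinder_core U n) = U"
proof
  show "(\<Union>n. cylinder_core U n) \<subseteq> U"
    unfolding cylinder_core_def using self_in_cylinder by blast
  show "U \<subseteq> (\<Union>n. cylinder_core U n)"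
    using assms by (auto simp: open_cantor_iff cylinder_core_def)
qed

lemma open_in_sets_coin:
  assumes "open U"
  shows "U \<in> sets coin_measure"
proof -
  have "(\<Union>n. cylinder_core U n) \<in> sets coin_measure"
    using determined_below_in_sets[OF determined_below_cylinder_core] by blast
  then show ?thesis by (simp add: UN_cylinder_core[OF assms])
qed

text \<open>Regularity, stated symmetrically in \<open>A\<close> and \<open>- A\<close> so that complements are immediate.\<close>
lemma coin_regular:
  assumes "A \<in> sets coin_measure" "e > 0"
  shows "\<exists>U V. open U \<and> open V \<and> A \<subseteq> U \<and> - A \<subseteq> V \<and> measure coin_measure (U \<inter> V) < e"
proof -
  have "A \<in> sigma_sets UNIV {{f :: cantor. f i \<in> B} | i B. True}"
    using assms(1) by (simp add: coin_measure_def sets_PiM_single)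
  then show ?thesis
    using assms(2)
  proof (induction A arbitrary: e)
    case (Basic A)
    then obtain i B where A: "A = {f. f i \<in> B}" by blast
    have "determined_below (Suc i) A" unfolding determined_below_def cylinder_def A by auto
    then have "A \<in> clopen_sets" by (rule clopen_if_determined_below)
    then have "open A" "open (- A)" by (auto simp: clopen_sets_def)
    then show ?case using Basic.prems by (intro exI[of _ A] exI[of _ "- A"]) auto
  next
    case Empty
    then show ?case by (intro exI[of _ "{}"] exI[of _ UNIV]) auto
  next
    case (Compl A)
    from Compl.IH[OF Compl.prems] obtain U V
      where "open U" "open V" "A \<subseteq> U" "- A \<subseteq> V" "measure coin_measure (U \<inter> V) < e"
      by (elim exE conjE)
    then show ?case by (intro exI[of _ V] exI[of _ U]) (auto simp: Int_commute)
  next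
    case (Union A)
    have "\<exists>U V. open U \<and> open V \<and> A i \<subseteq> U \<and> - A i \<subseteq> V \<and>
        measure coin_measure (U \<inter> V) < e / 4 * (1/2) ^ i" for i
      using Union.IH[of "e / 4 * (1/2) ^ i" i] Union.prems by simp
    then obtain U V where op: "\<And>i. open (U i)" "\<And>i. open (V i)"
      and AU: "\<And>i. A i \<subseteq> U i" and AV: "\<And>i. - A i \<subseteq> V i"
      and small: "\<And>i. measure coin_measure (U i \<inter> V i) < e / 4 * (1/2) ^ i"
      by metis
    note sets = open_in_sets_coin[OF op(1)] open_in_sets_coin[OF op(2)]
    \<comment> \<open>The intersection of all \<open>V i\<close> need not be open, so only finitely
      many are kept; \<open>N\<close> is chosen so that the later \<open>U i\<close> add less than
      \<open>e / 2\<close>. The overlaps \<open>U i \<inter> V i\<close> cost at most the other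
      \<open>e / 2\<close>.\<close>
    define W where "W N = (\<Union>i<N. U i)" for N
    have W_sets: "W N \<in> sets coin_measure" for N unfolding W_def using sets by blast
    have W_UN: "(\<Union>N. W N) = (\<Union>i. U i)" unfolding W_def by blast
    have "incseq W" unfolding W_def incseq_def by fastforce
    then have "(\<lambda>N. measure coin_measure (W N)) \<longlonglongrightarrow> measure coin_measure (\<Union>i. U i)"
      using coin.finite_Lim_measure_incseq[of W] W_sets W_UN by auto
    then have "\<forall>\<^sub>F N in sequentially. measure coin_measure (\<Union>i. U i) - e / 2 < measure coin_measure (W N)"
      using Union.prems by (intro order_tendstoD(1)) auto
    then obtain N where N: "measure coin_measure (\<Union>i. U i) - e / 2 < measure coin_measure (W N)"
      by (auto simp: eventually_sequentially)
    have rest: "measure coin_measure ((\<Union>i. U i) - W N) < e / 2"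
      using N W_sets sets(1) by (subst coin.finite_measure_Diff) (auto simp: W_def)
    have geo: "(\<lambda>i. e / 4 * (1/2) ^ i) sums (e / 4 * 2)"
      using sums_mult[OF geometric_sums[of "1/2 :: real"], of "e / 4"] by simp
    have summ: "summable (\<lambda>i. measure coin_measure (U i \<inter> V i))"
      by (rule summable_comparison_test'[OF sums_summable[OF geo], of 0])
         (use small in \<open>auto intro: less_imp_le\<close>)
    have "measure coin_measure (\<Union>i. U i \<inter> V i) \<le> (\<Sum>i. measure coin_measure (U i \<inter> V i))"
      using sets summ by (intro coin.finite_measure_subadditive_countably) auto
    also have "\<dots> \<le> (\<Sum>i. e / 4 * (1/2) ^ i)"
      using small summ sums_summable[OF geo] by (intro suminf_le) (auto intro: less_imp_le)
    also have "\<dots> = e / 2" using sums_unique[OF geo] by simp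
    finally have overlap: "measure coin_measure (\<Union>i. U i \<inter> V i) \<le> e / 2" .
    define V' where "V' = (\<Inter>i<N. V i)"
    have sub: "(\<Union>i. U i) \<inter> V' \<subseteq> (\<Union>i. U i \<inter> V i) \<union> ((\<Union>i. U i) - W N)"
      unfolding V'_def W_def by blast
    have "measure coin_measure ((\<Union>i. U i) \<inter> V')
        \<le> measure coin_measure ((\<Union>i. U i \<inter> V i) \<union> ((\<Union>i. U i) - W N))"
      using sets W_sets by (intro coin.finite_measure_mono[OF sub]) auto
    also have "\<dots> \<le> measure coin_measure (\<Union>i. U i \<inter> V i) + measure coin_measure ((\<Union>i. U i) - W N)"
      using sets W_sets by (intro measure_Un_le) auto
    also have "\<dots> < e" using overlap rest by simp
    finally have "measure coin_measure ((\<Union>i. U i) \<inter> V') < e" .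
    moreover have "open (\<Union>i. U i)" "open V'" unfolding V'_def using op by auto
    moreover have "(\<Union>i. A i) \<subseteq> (\<Union>i. U i)" "- (\<Union>i. A i) \<subseteq> V'"
      unfolding V'_def using AU AV by blast+
    ultimately show ?case by (intro exI[of _ "\<Union>i. U i"] exI[of _ V'] conjI)
  qed
qed

text \<open>In the pair given by regularity, \<open>- X \<subseteq> V\<close>, so \<open>U\<close>
  exceeds \<open>U \<inter> V\<close> only by points of the null set \<open>X\<close>.\<close>

lemma null_set_open_cover:
  assumes "X \<in> null_sets coin_measure" "e > 0"
  obtains U where "open U" "X \<subseteq> U" "measure coin_measure U < e"
proof -
  obtain U V where U: "open U" "open V" "X \<subseteq> U" "- X \<subseteq> V" "measure coin_measure (U \<inter> V) < e"
    using coin_regular[OF null_setsD2[OF assms(1)] assms(2)] by (elim exE conjE)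
  note sets = open_in_sets_coin[OF U(1)] open_in_sets_coin[OF U(2)]
  have "measure coin_measure U \<le> measure coin_measure ((U \<inter> V) \<union> X)"
    using sets assms(1) U(4) by (intro coin.finite_measure_mono) auto
  also have "\<dots> = measure coin_measure (U \<inter> V)"
    using sets assms(1) by (intro measure_Un_null_set) auto
  finally have "measure coin_measure U < e" using U(5) by simp
  with U(1,3) show ?thesis by (rule that)
qed

lemma N_limsup_eq_limsup: "N_limsup c = limsup c"
  unfolding limsup_INF_SUP N_limsup_def infinite_nat_iff_unbounded_le by auto

lemma null_N_limsup:
  assumes "\<And>k. U k \<in> sets coin_measure" "\<And>k. measure coin_measure (U k) \<le> (1/2) ^ k"
  shows "N_limsup U \<in> null_sets coin_measure"
  unfolding N_limsup_eq_limsup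
proof (rule borel_cantelli_limsup1)
  show "summable (\<lambda>k. measure coin_measure (U k))"
    by (rule summable_comparison_test'[of "\<lambda>k. (1/2) ^ k" 0]) (use assms(2) in auto)
qed (use assms(1) in \<open>auto simp: coin.emeasure_eq_measure\<close>)

text \<open>Cover the null set by open sets \<open>U k\<close> of measure below
  \<open>(1/2) ^ k\<close>, cut each into disjoint clopen pieces, and list all pieces in a single
  sequence. A covered point meets a piece for every \<open>k\<close>; a point in infinitely many
  pieces lies in infinitely many \<open>U k\<close>, and such points form a null set by
  Borel-Cantelli.\<close>

lemma null_set_subset_N_limsup:
  assumes "X \<in> null_sets cantor_measure"
  obtains c where "c \<in> Omega_bar" "X \<subseteq> N_limsup c"
proof -
  obtain Y where Y: "Y \<in> null_sets coin_measure" "X \<subseteq> Y"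
    using assms unfolding cantor_measure_eq null_sets_completion_iff2 by blast
  have "\<exists>U. open U \<and> Y \<subseteq> U \<and> measure coin_measure U < (1/2) ^ k" for k :: nat
    using null_set_open_cover[OF Y(1), of "(1/2) ^ k"] by (metis half_gt_zero_iff zero_less_one zero_less_power)
  then obtain U where U: "\<And>k. open (U k)" "\<And>k. Y \<subseteq> U k"
    and small: "\<And>k. measure coin_measure (U k) < (1/2) ^ k" by metis
  \<comment> \<open>The cores increase with \<open>j\<close> and exhaust \<open>U k\<close>; their
    successive differences are disjoint, and each depends on finitely many coordinates only.\<close>
  define D where "D k j = cylinder_core (U k) j - (\<Union>i<j. cylinder_core (U k) i)" for k j
  have D_det: "determined_below j (D k j)" for k j
    unfolding D_def
    by (intro determined_below_Diff determined_below_UN determined_below_cylinder_core)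
       (auto intro: determined_below_mono[OF determined_below_cylinder_core])
  have D_ex: "\<exists>j. x \<in> D k j" if "x \<in> U k" for x k
  proof -
    have ex: "\<exists>j. x \<in> cylinder_core (U k) j" using that UN_cylinder_core[OF U(1)[of k]] by blast
    show ?thesis
      using LeastI_ex[OF ex] not_less_Least[of _ "\<lambda>j. x \<in> cylinder_core (U k) j"]
      unfolding D_def by blast
  qed
  have D_sub: "D k j \<subseteq> U k" for k j
    unfolding D_def using UN_cylinder_core[OF U(1)[of k]] by blast
  have D_uniq: "i = j" if "x \<in> D k i" "x \<in> D k j" for x k i j
    using that unfolding D_def by (metis (no_types, lifting) DiffE UN_I lessThan_iff linorder_neqE_nat)
  define c where "c n = (case prod_decode n of (k, j) \<Rightarrow> D k j)" for n
  have c_encode: "c (prod_encode (k, j)) = D k j" for k j by (simp add: c_def)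
  have "N_limsup c \<subseteq> N_limsup U"
  proof
    fix x assume "x \<in> N_limsup c"
    then have inf: "infinite {n. x \<in> c n}" by (simp add: N_limsup_def)
    \<comment> \<open>Disjointness lets \<open>x\<close> lie in at most one piece for each
      \<open>k\<close>, so infinitely many pieces require infinitely many \<open>k\<close>.\<close>
    have inj: "inj_on (\<lambda>n. fst (prod_decode n)) {n. x \<in> c n}"
    proof (rule inj_onI)
      fix n n' assume n: "n \<in> {n. x \<in> c n}" "n' \<in> {n. x \<in> c n}"
        "fst (prod_decode n) = fst (prod_decode n')"
      then have "snd (prod_decode n) = snd (prod_decode n')"
        by (intro D_uniq[of x "fst (prod_decode n)"]) (auto simp: c_def split_beta)
      with n(3) show "n = n'" by (metis prod_decode_inverse prod_eq_iff)
    qed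
    have "(\<lambda>n. fst (prod_decode n)) ` {n. x \<in> c n} \<subseteq> {k. x \<in> U k}"
      using D_sub by (auto simp: c_def split_beta)
    then have "infinite {k. x \<in> U k}"
      using finite_imageD[OF finite_subset inj] inf by blast
    then show "x \<in> N_limsup U" by (simp add: N_limsup_def)
  qed
  moreover have "N_limsup U \<in> null_sets coin_measure"
    by (rule null_N_limsup) (use U(1) small in \<open>auto intro: open_in_sets_coin less_imp_le\<close>)
  ultimately have "N_limsup c \<in> null_sets cantor_measure"
    unfolding cantor_measure_eq null_sets_completion_iff2 by blast
  moreover have "c n \<in> clopen_sets" for n
    by (auto simp: c_def split_beta intro: clopen_if_determined_below[OF D_det])
  ultimately have c: "c \<in> Omega_bar" by (simp add: Omega_bar_def)
  have "X \<subseteq> N_limsup c"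
  proof
    fix x assume "x \<in> X"
    then have "\<forall>k. \<exists>j. x \<in> D k j" using Y(2) U(2) D_ex by blast
    then obtain j where j: "\<And>k. x \<in> D k (j k)" by metis
    have "range (\<lambda>k. prod_encode (k, j k)) \<subseteq> {n. x \<in> c n}" using j by (auto simp: c_encode)
    moreover have "infinite (range (\<lambda>k. prod_encode (k, j k)))"
      by (rule range_inj_infinite) (auto simp: inj_def)
    ultimately show "x \<in> N_limsup c"
      unfolding N_limsup_def using finite_subset by blast
  qed
  with c show ?thesis by (rule that)
qed

section \<open>Invariance of the coin measure under flipping coordinates\<close>

definition flip :: "nat set \<Rightarrow> cantor \<Rightarrow> cantor" where
  "flip S x = (\<lambda>i. x i \<noteq> (i \<in> S))"

lemma flip_measurable: "flip S \<in> measurable coin_measure coin_measure"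
  unfolding coin_measure_def flip_def
  by (rule measurable_PiM_single') (auto intro: measurable_compose[OF measurable_component_singleton])

lemma fair_coin_flip:
  "emeasure (measure_pmf (bernoulli_pmf (1/2))) {b. (b \<noteq> s) \<in> B} =
   emeasure (measure_pmf (bernoulli_pmf (1/2))) B"
proof -
  have p: "pmf (bernoulli_pmf (1/2)) b = 1/2" for b by (cases b) auto
  have "bij_betw (\<lambda>b. b \<noteq> s) {b. (b \<noteq> s) \<in> B} B"
    by (rule bij_betwI[where g = "\<lambda>b. b \<noteq> s"]) (cases s; auto)+
  then have "card {b. (b \<noteq> s) \<in> B} = card B" by (rule bij_betw_same_card)
  then show ?thesis by (simp add: emeasure_measure_pmf_finite p)
qed

text \<open>The product measure is determined by its values on sets given by finitely many
  coordinates, and there a flip acts coordinatewise by a symmetry of the fair coin.\<close>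

lemma distr_flip: "distr coin_measure coin_measure (flip S) = coin_measure"
proof -
  let ?M = "\<lambda>_::nat. measure_pmf (bernoulli_pmf (1/2))"
  have "distr coin_measure coin_measure (flip S) = Pi\<^sub>M UNIV ?M"
  proof (rule fair_coins.PiM_eq)
    show "sets (distr coin_measure coin_measure (flip S)) = sets (Pi\<^sub>M UNIV ?M)"
      by (simp add: coin_measure_def)
    fix J :: "nat set" and F assume J: "finite J"
    have emb: "prod_emb UNIV ?M J (Pi\<^sub>E J F) \<in> sets coin_measure"
      unfolding coin_measure_def using J by (intro sets_PiM_I) auto
    have "emeasure (distr coin_measure coin_measure (flip S)) (prod_emb UNIV ?M J (Pi\<^sub>E J F))
        = emeasure coin_measure (flip S -` prod_emb UNIV ?M J (Pi\<^sub>E J F))"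
      by (simp add: emeasure_distr[OF flip_measurable emb])
    also have "flip S -` prod_emb UNIV ?M J (Pi\<^sub>E J F)
        = prod_emb UNIV ?M J (\<Pi>\<^sub>E j\<in>J. {b. (b \<noteq> (j \<in> S)) \<in> F j})"
      unfolding pattern_eq_prod_emb[symmetric] by (auto simp: flip_def)
    also have "emeasure coin_measure \<dots> = (\<Prod>j\<in>J. emeasure (?M j) {b. (b \<noteq> (j \<in> S)) \<in> F j})"
      unfolding coin_measure_def using J by (intro fair_coins.emeasure_PiM_emb) auto
    also have "\<dots> = (\<Prod>j\<in>J. emeasure (?M j) (F j))"
      by (simp only: fair_coin_flip)
    finally show "emeasure (distr coin_measure coin_measure (flip S)) (prod_emb UNIV ?M J (Pi\<^sub>E J F))
        = (\<Prod>j\<in>J. emeasure (?M j) (F j))" .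
  qed
  then show ?thesis by (simp add: coin_measure_def)
qed

lemma measure_flip_vimage:
  assumes "d \<in> sets coin_measure"
  shows "flip S -` d \<in> sets coin_measure" "measure coin_measure (flip S -` d) = measure coin_measure d"
proof -
  show "flip S -` d \<in> sets coin_measure"
    using measurable_sets[OF flip_measurable assms, of S] by simp
  show "measure coin_measure (flip S -` d) = measure coin_measure d"
    using measure_distr[OF flip_measurable assms, of S] by (simp add: distr_flip)
qed

text \<open>Erasing the coordinates in \<open>Z\<close> is, pointwise, one of the \<open>2 ^ card Z\<close> measure-preserving flips.\<close>
lemma erase_vimage_small:
  assumes Z: "finite Z" and d: "d \<in> sets coin_measure"
  obtains E where "E \<in> sets coin_measure" "\<And>x. (\<lambda>i. i \<notin> Z \<and> x i) \<in> d \<Longrightarrow> x \<in> E"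
    "measure coin_measure E \<le> 2 ^ card Z * measure coin_measure d"
proof -
  define E where "E = (\<Union>S\<in>Pow Z. flip S -` d)"
  have "E \<in> sets coin_measure"
    unfolding E_def using Z measure_flip_vimage(1)[OF d] by (intro sets.finite_UN) auto
  moreover have "x \<in> E" if "(\<lambda>i. i \<notin> Z \<and> x i) \<in> d" for x
  proof -
    have "(\<lambda>i. i \<notin> Z \<and> x i) = flip {i \<in> Z. x i} x" by (auto simp: flip_def)
    then show ?thesis unfolding E_def using that by (intro UN_I[of "{i \<in> Z. x i}"]) auto
  qed
  moreover have "measure coin_measure E \<le> (\<Sum>S\<in>Pow Z. measure coin_measure (flip S -` d))"
    unfolding E_def using Z measure_flip_vimage(1)[OF d]
    by (intro measure_UNION_le) auto
  then have "measure coin_measure E \<le> 2 ^ card Z * measure coin_measure d"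
    using Z by (simp add: measure_flip_vimage(2)[OF d] card_Pow)
  ultimately show ?thesis by (rule that)
qed

section \<open>Meager ideals\<close>

text \<open>A \<open>J\<close>-positive set is infinite because \<open>J\<close> contains all finite
  sets.\<close>

lemma N_J_family_subset_null:
  assumes "ideal_on_omega J"
  shows "N_J_family J \<subseteq> null_ideal"
proof
  fix X assume "X \<in> N_J_family J"
  then obtain c where c: "c \<in> Omega_bar" "X \<subseteq> N_J_set J c"
    unfolding N_J_family_def by blast
  have "N_J_set J c \<subseteq> N_limsup c"
    using assms by (auto simp: N_J_set_def N_limsup_def positive_sets_def ideal_on_omega_def)
  then have "X \<subseteq> N_limsup c" using c(2) by simp
  moreover have "N_limsup c \<in> null_sets cantor_measure" using c(1) by (simp add: Omega_bar_def)
  ultimately show "X \<in> null_ideal"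
    unfolding null_ideal_def cantor_measure_eq by (rule null_sets_completion_subset)
qed

text \<open>Repeating \<open>c k\<close> along the \<open>k\<close>-th interval of the partition turns infinite sets of indices
  into \<open>J\<close>-positive ones.\<close>
lemma null_subset_N_J_family_if_meager:
  assumes J: "ideal_on_omega J" and "meager (cantor_of J)"
  shows "null_ideal \<subseteq> N_J_family J"
proof
  fix X assume "X \<in> null_ideal"
  then obtain c where c: "c \<in> Omega_bar" "X \<subseteq> N_limsup c"
    using null_set_subset_N_limsup unfolding null_ideal_def by auto
  have down: "\<forall>A\<in>J. \<forall>B. B \<subseteq> A \<longrightarrow> B \<in> J" using J by (simp add: ideal_on_omega_def)
  obtain m where m: "m 0 = 0" "strict_mono m"
    and fin: "\<forall>A\<in>J. finite {k. {m k..<m (Suc k)} \<subseteq> A}"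
    using meager_ideal_partition[OF down assms(2)] .
  have "\<forall>n. \<exists>k. n \<in> {m k..<m (Suc k)}"
    using strict_mono_interval_exists[OF m(2)] m(1) by simp
  then obtain idx where idx: "\<And>n. n \<in> {m (idx n)..<m (Suc (idx n))}" by metis
  define c' where "c' n = c (idx n)" for n
  have interval: "{m k..<m (Suc k)} \<subseteq> {n. x \<in> c' n}" if "x \<in> c k" for x k
  proof
    fix n assume "n \<in> {m k..<m (Suc k)}"
    then have "idx n = k" by (rule strict_mono_interval_unique[OF m(2) idx])
    then show "n \<in> {n. x \<in> c' n}" using that by (simp add: c'_def)
  qed
  have "N_limsup c' \<subseteq> N_limsup c"
  proof
    fix x assume x: "x \<in> N_limsup c'"
    \<comment> \<open>The intervals are finite, so infinitely many indices of \<open>c'\<close> come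
      from infinitely many indices of \<open>c\<close>; the repetition thus keeps \<open>c'\<close>
      in \<open>Omega_bar\<close>.\<close>
    have "{n. x \<in> c' n} \<subseteq> (\<Union>k\<in>{k. x \<in> c k}. {m k..<m (Suc k)})"
      using idx unfolding c'_def by blast
    then have "infinite {k. x \<in> c k}"
      using x unfolding N_limsup_def by (auto dest: finite_subset)
    then show "x \<in> N_limsup c" by (simp add: N_limsup_def)
  qed
  then have "c' \<in> Omega_bar"
    using c(1) null_sets_completion_subset[of "N_limsup c'" "N_limsup c" coin_measure]
    by (auto simp: Omega_bar_def c'_def cantor_measure_eq)
  moreover have "X \<subseteq> N_J_set J c'"
  proof
    fix x assume "x \<in> X"
    then have inf: "infinite {k. x \<in> c k}" using c(2) by (auto simp: N_limsup_def)
    have "{k. x \<in> c k} \<subseteq> {k. {m k..<m (Suc k)} \<subseteq> {n. x \<in> c' n}}" using interval by blast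
    then have "{n. x \<in> c' n} \<notin> J" using fin inf finite_subset by blast
    then show "x \<in> N_J_set J c'" by (simp add: N_J_set_def positive_sets_def)
  qed
  ultimately show "X \<in> N_J_family J" unfolding N_J_family_def by blast
qed

section \<open>Nonmeager ideals\<close>

text \<open>Blocks with index below \<open>j\<close> lie below coordinate \<open>2 ^ j\<close>, and
  block \<open>j\<close> has \<open>2 ^ j\<close> members, so the measures of
  \<open>constant_on_block b j\<close> are summable.\<close>

definition dyadic_block :: "nat \<Rightarrow> nat set" where
  "dyadic_block j = {2 ^ j..<2 * 2 ^ j}"

definition constant_on_block :: "bool \<Rightarrow> nat \<Rightarrow> cantor set" where
  "constant_on_block b j = {x. \<forall>i\<in>dyadic_block j. x i = b}"

text \<open>The first set is null; discarding the second, whose complement is meager, makes the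
  difference meager as well. The second set is itself null, so almost no point is lost to
  it.\<close>

definition witness_set :: "cantor set" where
  "witness_set = N_limsup (constant_on_block False) - N_limsup (constant_on_block True)"

lemma null_N_limsup_constant_on_block: "N_limsup (constant_on_block b) \<in> null_sets coin_measure"
proof (rule null_N_limsup)
  fix j
  show "constant_on_block b j \<in> sets coin_measure"
    using pattern_in_sets[of "dyadic_block j" "\<lambda>_. b"]
    by (simp add: constant_on_block_def dyadic_block_def)
  have "measure coin_measure (constant_on_block b j) = (1/2) ^ card (dyadic_block j)"
    unfolding constant_on_block_def by (rule measure_pattern) (simp add: dyadic_block_def)
  also have "\<dots> \<le> (1/2) ^ j"
    by (rule power_decreasing) (auto simp: dyadic_block_def intro: less_imp_le[OF less_exp])
  finally show "measure coin_measure (constant_on_block b j) \<le> (1/2) ^ j" .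
qed

lemma witness_set_null: "witness_set \<in> null_ideal"
  unfolding null_ideal_def cantor_measure_eq witness_set_def
  by (rule null_sets_completion_subset[OF Diff_subset null_sets_completionI])
     (rule null_N_limsup_constant_on_block)

lemma witness_set_meager: "witness_set \<in> meager_ideal"
proof -
  have "meager {x :: cantor. \<exists>k. \<forall>j\<ge>k. \<exists>n\<in>dyadic_block j. \<not> x n}"
    by (rule meager_eventually_omits)
       (auto simp: dyadic_block_def intro: order_trans[OF less_imp_le[OF less_exp]])
  moreover have "witness_set \<subseteq> {x. \<exists>k. \<forall>j\<ge>k. \<exists>n\<in>dyadic_block j. \<not> x n}"
    by (auto simp: witness_set_def N_limsup_def constant_on_block_def finite_nat_set_iff_bounded not_less
        dest!: leD) (meson leD)
  ultimately show ?thesis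
    unfolding meager_ideal_def using meager_subset by blast
qed

section \<open>Scales adapted to a given sequence, and the point that avoids it\<close>

lemma tail_measure_tendsto_0:
  assumes "c \<in> Omega_bar"
  shows "(\<lambda>m. measure coin_measure (\<Union>n\<in>{m..}. c n)) \<longlonglongrightarrow> 0"
proof -
  have sets: "c n \<in> sets coin_measure" for n
    using assms clopen_in_sets by (simp add: Omega_bar_def)
  have lim: "N_limsup c = (\<Inter>m. \<Union>n\<in>{m..}. c n)"
    by (simp add: N_limsup_eq_limsup limsup_INF_SUP)
  \<comment> \<open>\<open>Omega_bar\<close> yields nullness in the completion only; measurability
    carries it back to \<open>coin_measure\<close>, where continuity from above applies.\<close>
  then have "N_limsup c \<in> sets coin_measure" using sets by auto
  then have "N_limsup c \<in> null_sets coin_measure"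
    using assms by (simp add: Omega_bar_def cantor_measure_eq null_sets_completion_iff)
  then have "measure coin_measure (\<Inter>m. \<Union>n\<in>{m..}. c n) = 0"
    by (simp add: lim measure_eq_0_null_sets)
  moreover have "(\<lambda>m. measure coin_measure (\<Union>n\<in>{m..}. c n))
      \<longlonglongrightarrow> measure coin_measure (\<Inter>m. \<Union>n\<in>{m..}. c n)"
  proof (rule coin.finite_Lim_measure_decseq)
    show "decseq (\<lambda>m. \<Union>n\<in>{m..}. c n)" unfolding decseq_def by (intro allI impI UN_mono) auto
  qed (use sets in auto)
  ultimately show ?thesis by simp
qed

text \<open>The sequences are chosen in turn: \<open>m (Suc k)\<close> so large that the tail of
  \<open>c\<close> stays small after multiplication by \<open>2 ^ (2 * 2 ^ j k)\<close>, then
  \<open>j (Suc k)\<close> so large that its block starts beyond all coordinates relevant to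
  \<open>c n\<close> with \<open>n < m (Suc k)\<close>. The exponent is the right end of block
  \<open>j k\<close>, so the factor counts the flips of coordinates up to there.\<close>

lemma interleaved_scales:
  assumes c: "c \<in> Omega_bar"
  obtains m j :: "nat \<Rightarrow> nat" where "strict_mono m" "strict_mono j"
    "\<forall>k. \<forall>n<m k. determined_below (2 ^ j k) (c n)"
    "measure coin_measure (\<Union>n\<in>{m 0..}. c n) \<le> 1/4"
    "\<forall>k. 2 ^ (2 * 2 ^ j k) * measure coin_measure (\<Union>n\<in>{m (Suc k)..}. c n) \<le> (1/2) ^ (k + 3)"
proof -
  have "\<exists>d. determined_below d (c n)" for n
    using c clopen_determined_below[of "c n"] unfolding Omega_bar_def by blast
  then obtain d where d: "\<And>n. determined_below (d n) (c n)" by metis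
  have det: "\<exists>j>j0. \<forall>n<m. determined_below (2 ^ j) (c n)" for j0 m :: nat
  proof (intro exI conjI allI impI)
    show "j0 < Suc (j0 + (\<Sum>n<m. d n))" by simp
    fix n assume n: "n < m"
    have "d n \<le> (\<Sum>n<m. d n)" using n by (intro member_le_sum) auto
    also have "\<dots> \<le> Suc (j0 + (\<Sum>n<m. d n))" by simp
    also have "\<dots> \<le> 2 ^ Suc (j0 + (\<Sum>n<m. d n))" by (rule less_imp_le[OF less_exp])
    finally show "determined_below (2 ^ Suc (j0 + (\<Sum>n<m. d n))) (c n)"
      by (rule determined_below_mono[OF d])
  qed
  have tail: "\<exists>m>m0. measure coin_measure (\<Union>n\<in>{m..}. c n) \<le> e" if "e > 0" for e and m0 :: nat
  proof -
    have "\<forall>\<^sub>F m in sequentially. measure coin_measure (\<Union>n\<in>{m..}. c n) < e"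
      using tail_measure_tendsto_0[OF c] that by (rule order_tendstoD(2))
    then obtain M where "\<And>m. m \<ge> M \<Longrightarrow> measure coin_measure (\<Union>n\<in>{m..}. c n) < e"
      by (auto simp: eventually_sequentially)
    then show ?thesis by (intro exI[of _ "max M (Suc m0)"]) (auto intro: less_imp_le)
  qed
  \<comment> \<open>No block is erased before stage 0, so the first tail only has to be small in
    absolute terms.\<close>
  define P where "P k p \<longleftrightarrow> (\<forall>n<fst p. determined_below (2 ^ snd p) (c n)) \<and>
      (k = 0 \<longrightarrow> measure coin_measure (\<Union>n\<in>{fst p..}. c n) \<le> 1/4)" for k :: nat and p :: "nat \<times> nat"
  define Q where "Q k p q \<longleftrightarrow> fst p < fst q \<and> snd p < snd q \<and>
      2 ^ (2 * 2 ^ snd p) * measure coin_measure (\<Union>n\<in>{fst q..}. c n) \<le> (1/2) ^ (k + 3)"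
    for k :: nat and p q :: "nat \<times> nat"
  have "\<exists>f. \<forall>k. P k (f k) \<and> Q k (f k) (f (Suc k))"
  proof (rule dependent_nat_choice)
    obtain m0 where "measure coin_measure (\<Union>n\<in>{m0..}. c n) \<le> 1/4" using tail[of "1/4" 0] by auto
    moreover obtain j0 where "\<forall>n<m0. determined_below (2 ^ j0) (c n)" using det[of 0 m0] by auto
    ultimately show "\<exists>p. P 0 p" by (intro exI[of _ "(m0, j0)"]) (simp add: P_def)
  next
    fix p k
    obtain m1 where m1: "m1 > fst p"
      "measure coin_measure (\<Union>n\<in>{m1..}. c n) \<le> (1/2) ^ (k + 3) / 2 ^ (2 * 2 ^ snd p)"
      using tail[of "(1/2) ^ (k + 3) / 2 ^ (2 * 2 ^ snd p)" "fst p"] by auto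
    obtain j1 where "j1 > snd p" "\<forall>n<m1. determined_below (2 ^ j1) (c n)" using det[of "snd p" m1] by auto
    then show "\<exists>q. P (Suc k) q \<and> Q k p q"
      using m1 by (intro exI[of _ "(m1, j1)"]) (simp add: P_def Q_def field_simps)
  qed
  then obtain f where P: "\<And>k. P k (f k)" and Q: "\<And>k. Q k (f k) (f (Suc k))" by blast
  show ?thesis
  proof (rule that[of "\<lambda>k. fst (f k)" "\<lambda>k. snd (f k)"])
    show "strict_mono (\<lambda>k. fst (f k))" "strict_mono (\<lambda>k. snd (f k))"
      using Q by (simp_all add: strict_mono_Suc_iff Q_def)
    show "measure coin_measure (\<Union>n\<in>{fst (f 0)..}. c n) \<le> 1/4" using P[of 0] by (simp add: P_def)
    show "\<forall>k. \<forall>n<fst (f k). determined_below (2 ^ snd (f k)) (c n)"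
      using P by (simp add: P_def)
    show "\<forall>k. 2 ^ (2 * 2 ^ snd (f k)) * measure coin_measure (\<Union>n\<in>{fst (f (Suc k))..}. c n)
        \<le> (1/2) ^ (k + 3)"
      using Q by (simp add: Q_def)
  qed
qed

text \<open>A random point is erased on one dyadic block per \<open>k \<in> K\<close>. For \<open>k \<notin> K\<close>, the sets \<open>c n\<close> of the
  \<open>k\<close>-th interval only see blocks erased before stage \<open>k\<close>, and \<open>c n\<close> was chosen small enough to
  absorb the resulting increase in measure.\<close>
lemma witness_avoiding_off_infinite_set:
  assumes c: "c \<in> Omega_bar"
  obtains m :: "nat \<Rightarrow> nat" where "strict_mono m"
    "\<forall>K. infinite K \<longrightarrow> (\<exists>y\<in>witness_set. \<forall>k. k \<notin> K \<longrightarrow> (\<forall>n\<in>{m k..<m (Suc k)}. y \<notin> c n))"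
proof -
  obtain m j :: "nat \<Rightarrow> nat" where m: "strict_mono m" and j: "strict_mono j"
    and det: "\<forall>k. \<forall>n<m k. determined_below (2 ^ j k) (c n)"
    and small0: "measure coin_measure (\<Union>n\<in>{m 0..}. c n) \<le> 1/4"
    and small: "\<forall>k. 2 ^ (2 * 2 ^ j k) * measure coin_measure (\<Union>n\<in>{m (Suc k)..}. c n) \<le> (1/2) ^ (k + 3)"
    using interleaved_scales[OF c] .
  have c_sets: "c n \<in> sets coin_measure" for n
    using c clopen_in_sets by (simp add: Omega_bar_def)
  \<comment> \<open>\<open>l k\<close> bounds the blocks \<open>j i\<close> with
    \<open>i < k\<close>, those that may be erased before stage \<open>k\<close>; there are none for
    \<open>k = 0\<close>.\<close>
  define l :: "nat \<Rightarrow> nat" where "l k = (case k of 0 \<Rightarrow> 0 | Suc i \<Rightarrow> 2 * 2 ^ j i)" for k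
  have small_l: "2 ^ l k * measure coin_measure (\<Union>n\<in>{m k..}. c n) \<le> (1/2) ^ (k + 2)" for k
  proof (cases k)
    case (Suc i)
    then show ?thesis using small[rule_format, of i] by (simp add: l_def numeral_3_eq_3)
  qed (use small0 in \<open>simp add: l_def power2_eq_square\<close>)
  have avoid: "\<exists>y\<in>witness_set. \<forall>k. k \<notin> K \<longrightarrow> (\<forall>n\<in>{m k..<m (Suc k)}. y \<notin> c n)"
    if K: "infinite K" for K
  proof -
    define Z where "Z = (\<Union>k\<in>K. dyadic_block (j k))"
    have "\<exists>E. E \<in> sets coin_measure \<and> measure coin_measure E \<le> (1/2) ^ (k + 2) \<and>
        (k \<notin> K \<longrightarrow> (\<forall>x. \<forall>n\<in>{m k..<m (Suc k)}. (\<lambda>i. i \<notin> Z \<and> x i) \<in> c n \<longrightarrow> x \<in> E))" for k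
    proof (cases "k \<in> K")
      case True
      then show ?thesis by (intro exI[of _ "{}"]) simp
    next
      case False
      define D where "D = (\<Union>n\<in>{m k..<m (Suc k)}. c n)"
      have D_det: "determined_below (2 ^ j (Suc k)) D"
        unfolding D_def by (rule determined_below_UN) (use det in auto)
      have D_sets: "D \<in> sets coin_measure" unfolding D_def using c_sets by blast
      \<comment> \<open>Block \<open>j (Suc k)\<close> and later ones start too far out for
        \<open>D\<close>, and block \<open>j k\<close> is not erased since
        \<open>k \<notin> K\<close>; the remaining erased blocks end by \<open>l k\<close>.\<close>
      have erased_below: "i < l k" if i: "i \<in> Z" "i < 2 ^ j (Suc k)" for i
      proof -
        obtain k' where k': "k' \<in> K" "i \<in> dyadic_block (j k')" using i(1) by (auto simp: Z_def)
        have "(2::nat) ^ j k' < 2 ^ j (Suc k)" using k'(2) i(2) by (auto simp: dyadic_block_def simp del: power_strict_increasing_iff)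
        then have "j k' < j (Suc k)" by simp
        then have "k' < Suc k" using strict_mono_less[OF j] by simp
        moreover have "k' \<noteq> k" using k'(1) False by blast
        ultimately have "k' < k" by simp
        then obtain k'' where k'': "k = Suc k''" "k' \<le> k''" by (cases k) auto
        have "j k' \<le> j k''" using k''(2) strict_mono_less_eq[OF j] by simp
        then have "2 * 2 ^ j k' \<le> l k" by (simp add: l_def k''(1))
        then show ?thesis using k'(2) by (simp add: dyadic_block_def)
      qed
      \<comment> \<open>\<open>Z\<close> is infinite, so only the finite part that \<open>D\<close>
        can see is erased here.\<close>
      obtain E where E: "E \<in> sets coin_measure"
        "\<And>x. (\<lambda>i. i \<notin> Z \<inter> {..<l k} \<and> x i) \<in> D \<Longrightarrow> x \<in> E"
        "measure coin_measure E \<le> 2 ^ card (Z \<inter> {..<l k}) * measure coin_measure D"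
        using erase_vimage_small[of "Z \<inter> {..<l k}" D] D_sets by auto
      have "card (Z \<inter> {..<l k}) \<le> l k"
        using card_mono[of "{..<l k}" "Z \<inter> {..<l k}"] by simp
      then have "(2::real) ^ card (Z \<inter> {..<l k}) \<le> 2 ^ l k" by simp
      moreover have "measure coin_measure D \<le> measure coin_measure (\<Union>n\<in>{m k..}. c n)"
        using c_sets by (intro coin.finite_measure_mono) (auto simp: D_def)
      ultimately have "2 ^ card (Z \<inter> {..<l k}) * measure coin_measure D
          \<le> 2 ^ l k * measure coin_measure (\<Union>n\<in>{m k..}. c n)"
        by (intro mult_mono) auto
      then have "measure coin_measure E \<le> (1/2) ^ (k + 2)" using E(3) small_l[of k] by linarith
      moreover have "x \<in> E" if n: "n \<in> {m k..<m (Suc k)}" "(\<lambda>i. i \<notin> Z \<and> x i) \<in> c n" for x n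
      proof -
        have "(\<lambda>i. i \<notin> Z \<and> x i) \<in> D" using n by (auto simp: D_def)
        then have "(\<lambda>i. i \<notin> Z \<inter> {..<l k} \<and> x i) \<in> D"
          by (rule determined_below_cong[OF D_det, THEN iffD1, rotated]) (use erased_below in auto)
        then show ?thesis by (rule E(2))
      qed
      ultimately show ?thesis using E(1) by (intro exI[of _ E]) simp
    qed
    then have "\<exists>E. \<forall>k. E k \<in> sets coin_measure \<and> measure coin_measure (E k) \<le> (1/2) ^ (k + 2) \<and>
        (k \<notin> K \<longrightarrow> (\<forall>x. \<forall>n\<in>{m k..<m (Suc k)}. (\<lambda>i. i \<notin> Z \<and> x i) \<in> c n \<longrightarrow> x \<in> E k))"
      by (intro choice allI)
    then obtain E where E_all: "\<forall>k. E k \<in> sets coin_measure \<and> measure coin_measure (E k) \<le> (1/2) ^ (k + 2) \<and>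
        (k \<notin> K \<longrightarrow> (\<forall>x. \<forall>n\<in>{m k..<m (Suc k)}. (\<lambda>i. i \<notin> Z \<and> x i) \<in> c n \<longrightarrow> x \<in> E k))"
      by (elim exE)
    then have E: "E k \<in> sets coin_measure" and E_small: "measure coin_measure (E k) \<le> (1/2) ^ (k + 2)" for k
      by simp_all
    have E_hit: "x \<in> E k" if "k \<notin> K" "n \<in> {m k..<m (Suc k)}" "(\<lambda>i. i \<notin> Z \<and> x i) \<in> c n" for k x n
      using E_all[THEN spec, THEN conjunct2, THEN conjunct2, rule_format, OF that] .
    have geo: "(\<lambda>k. (1/2::real) ^ (k + 2)) sums (1/2)"
      using sums_mult[OF geometric_sums[of "1/2 :: real"], of "1/4"] by (simp add: power_add mult.commute)
    have summ: "summable (\<lambda>k. measure coin_measure (E k))"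
      by (rule summable_comparison_test'[OF sums_summable[OF geo], of 0]) (use E_small in auto)
    have "measure coin_measure (\<Union>k. E k) \<le> (\<Sum>k. measure coin_measure (E k))"
      using E summ by (intro coin.finite_measure_subadditive_countably) auto
    also have "\<dots> \<le> (\<Sum>k. (1/2) ^ (k + 2))"
      using E_small summ sums_summable[OF geo] by (intro suminf_le) auto
    also have "\<dots> = 1/2" using sums_unique[OF geo] by simp
    finally have UE: "measure coin_measure (\<Union>k. E k) \<le> 1/2" .
    \<comment> \<open>The exceptional sets have total measure at most 1/2, and the points with
      infinitely many blocks of ones add nothing, so some \<open>x\<close> remains.\<close>
    have "measure coin_measure ((\<Union>k. E k) \<union> N_limsup (constant_on_block True)) = measure coin_measure (\<Union>k. E k)"
      using E null_N_limsup_constant_on_block by (intro measure_Un_null_set) auto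
    then have "(\<Union>k. E k) \<union> N_limsup (constant_on_block True) \<noteq> UNIV"
      using UE coin.prob_space by auto
    then obtain x where x: "\<And>k. x \<notin> E k" "x \<notin> N_limsup (constant_on_block True)" by blast
    define y where "y = (\<lambda>i. i \<notin> Z \<and> x i)"
    have "j ` K \<subseteq> {i. y \<in> constant_on_block False i}"
      by (auto simp: constant_on_block_def y_def Z_def)
    moreover have "infinite (j ` K)"
      using K finite_imageD[OF _ inj_on_subset[OF strict_mono_imp_inj_on[OF j] subset_UNIV]] by blast
    ultimately have "y \<in> N_limsup (constant_on_block False)"
      unfolding N_limsup_def using finite_subset by blast
    \<comment> \<open>Erasing never creates a block of ones, so \<open>y\<close> inherits this
      property from \<open>x\<close>.\<close>
    moreover have "{i. y \<in> constant_on_block True i} \<subseteq> {i. x \<in> constant_on_block True i}"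
      by (auto simp: constant_on_block_def y_def)
    then have "y \<notin> N_limsup (constant_on_block True)"
      using x(2) finite_subset unfolding N_limsup_def by blast
    ultimately have "y \<in> witness_set" by (simp add: witness_set_def)
    moreover have "y \<notin> c n" if "k \<notin> K" "n \<in> {m k..<m (Suc k)}" for k n
      using E_hit[OF that, of x] x(1) unfolding y_def by blast
    ultimately show ?thesis by (intro bexI[of _ y]) simp_all
  qed
  show ?thesis by (rule that[OF m]) (use avoid in simp)
qed

text \<open>Take \<open>K\<close> to be the indices of the intervals inside one member
  \<open>A\<close> of \<open>J\<close>. The resulting \<open>y\<close> lies in \<open>c n\<close>
  only for \<open>n\<close> in \<open>A\<close> or below \<open>m 0\<close>, where no interval
  reaches; adding those finitely many indices to \<open>A\<close> stays in \<open>J\<close>.\<close>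

lemma witness_set_not_in_N_J_family:
  assumes J: "ideal_on_omega J" and nonmeager: "\<not> meager (cantor_of J)"
  shows "witness_set \<notin> N_J_family J"
proof
  assume "witness_set \<in> N_J_family J"
  then obtain c where c: "c \<in> Omega_bar" "witness_set \<subseteq> N_J_set J c"
    unfolding N_J_family_def by blast
  obtain m where m: "strict_mono m" and avoid: "\<forall>K. infinite K \<longrightarrow>
      (\<exists>y\<in>witness_set. \<forall>k. k \<notin> K \<longrightarrow> (\<forall>n\<in>{m k..<m (Suc k)}. y \<notin> c n))"
    using witness_avoiding_off_infinite_set[OF c(1)] .
  obtain A where A: "A \<in> J" "infinite {k. {m k..<m (Suc k)} \<subseteq> A}"
    using nonmeager_family_contains_intervals[OF nonmeager m] .
  obtain y where y: "y \<in> witness_set"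
    and off: "\<forall>k. k \<notin> {k. {m k..<m (Suc k)} \<subseteq> A} \<longrightarrow> (\<forall>n\<in>{m k..<m (Suc k)}. y \<notin> c n)"
    using avoid[rule_format, OF A(2)] by (elim bexE)
  have "{n. y \<in> c n} \<subseteq> {..<m 0} \<union> A"
  proof
    fix n assume n: "n \<in> {n. y \<in> c n}"
    show "n \<in> {..<m 0} \<union> A"
    proof (cases "n < m 0")
      case False
      then obtain k where "n \<in> {m k..<m (Suc k)}"
        using strict_mono_interval_exists[OF m, of n] by auto
      then show ?thesis using off n by blast
    qed simp
  qed
  moreover have "{..<m 0} \<union> A \<in> J" using J A(1) by (simp add: ideal_on_omega_def)
  ultimately have "{n. y \<in> c n} \<in> J" using J unfolding ideal_on_omega_def by blast
  moreover have "{n. y \<in> c n} \<notin> J"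
    using y c(2) by (auto simp: N_J_set_def positive_sets_def)
  ultimately show False by simp
qed

text \<open>If \<open>J\<close> is meager, \<open>N_J_family J\<close> equals
  \<open>null_ideal\<close> and all three conditions fail; otherwise \<open>witness_set\<close>
  yields both the strict inclusion and the failure of containment.\<close>

theorem theorem3p7:
  fixes J :: "nat set set"
  assumes "ideal_on_omega J"
  shows "(N_J_family J \<subset> null_ideal \<longleftrightarrow> \<not> (meager_ideal \<inter> null_ideal \<subseteq> N_J_family J)) \<and>
         (\<not> (meager_ideal \<inter> null_ideal \<subseteq> N_J_family J) \<longleftrightarrow> \<not> meager (cantor_of J))"
proof (cases "meager (cantor_of J)")
  case True
  then show ?thesis
    using null_subset_N_J_family_if_meager[OF assms] by blast
next
  case False
  then show ?thesis
    using witness_set_not_in_N_J_family[OF assms] witness_set_null witness_set_meager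
      N_J_family_subset_null[OF assms] by blast
qed

end
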